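(* Let $G$ be a topological group such that $\mathrm{S}(G)$ contains two disjoint closed, $G$-invariant, non-empty subsets. Then there exists $f\in\mathrm{RUCB}(G)$ with values in $[0,1]$ such that for every integer $n\ge1$ there exists $\nu\in\mathrm{M}(G^n)$ such that for every $\mu\in\mathrm{M}(G^n)$ $$(\mu\nu)\Bigl(\bigl(f_{n,n}-(\mu\nu)(f_{n,n})\bigr)^2\Bigr)=\tfrac14,$$ where $f_{n,n}\colon G^n\to\mathbb{R}$, $x\mapsto\frac1n\sum_{j=1}^nf(x_j)$.
   Context: For a topological group $G$ and $g\in G$ let $\lambda_g\colon G\to G$, $x\mapsto gx$. $\mathrm{RUCB}(G)$ is the unital real Banach algebra (supremum norm) of all bounded functions $f\colon G\to\mathbb{R}$ such that for every $\epsilon>0$ there is a neighborhood $U$ of $e$ with $\|f-f\circ\lambda_g\|_\infty\le\epsilon$ for all $g\in U$. $\mathrm{M}(G)$ is the set of means, i.e., positive unital linear functionals on $\mathrm{RUCB}(G)$. $\mathrm{S}(G)\subseteq\mathrm{M}(G)$ is the set of unital ring homomorphisms $\mathrm{RUCB}(G)\to\mathbb{R}$, a compact Hausdorff space in the weak-$*$ topology, on which $G$ acts by $(g\xi)(f):=\xi(f\circ\lambda_g)$. For $\nu\in\mathrm{M}(G)$ and $f\in\mathrm{RUCB}(G)$ let $(\Phi_\nu f)(g):=\nu(f\circ\lambda_g)$, which defines an element $\Phi_\nu f\in\mathrm{RUCB}(G)$; for $\mu,\nu\in\mathrm{M}(G)$, the convolution product is $\mu\nu:=\mu\circ\Phi_\nu\in\mathrm{M}(G)$.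 $G^n$ carries the product topology and coordinatewise group structure, and these notions are applied to $G^n$ too. Constants are identified with constant functions. *)

theory Defs
  imports "HOL-Analysis.Analysis" "HOL-Algebra.Product_Groups"
begin

text \<open>
  A topological group is a group \<open>G\<close> with carrier together with a topology \<open>T\<close> on that carrier.
  No separation axiom is assumed.  Explicit carriers are used because the powers of a
  fixed group occur for all exponents at once.
\<close>

locale topological_group = group G for G (structure) +
  fixes T :: "'a topology"
  assumes topspace_eq_carrier: "topspace T = carrier G"
    and continuous_mult: "continuous_map (prod_topology T T) T (\<lambda>(x, y). x \<otimes> y)"
    and continuous_inv: "continuous_map T T (\<lambda>x. inv x)"

definition power_group :: "('a, 'b) monoid_scheme \<Rightarrow> nat \<Rightarrow> (nat \<Rightarrow> 'a) monoid" where
  "power_group G n = product_group {1..n} (\<lambda>_. G)"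

definition power_topology :: "'a topology \<Rightarrow> nat \<Rightarrow> (nat \<Rightarrow> 'a) topology" where
  "power_topology T n = product_topology (\<lambda>_. T) {1..n}"

text \<open>
  Real functions on \<open>G\<close> are represented by functions that are extensional on the carrier, and
  functionals by functions that are extensional on \<open>RUCB G T\<close>, so that equality in HOL is
  equality of functions on the intended domain.  The following is \<open>f \<circ> \<lambda>\<^sub>g\<close>.
\<close>

definition translate :: "('a, 'b) monoid_scheme \<Rightarrow> 'a \<Rightarrow> ('a \<Rightarrow> real) \<Rightarrow> 'a \<Rightarrow> real" where
  "translate G g f = compose (carrier G) f (\<lambda>x. g \<otimes>\<^bsub>G\<^esub> x)"

definition RUCB :: "('a, 'b) monoid_scheme \<Rightarrow> 'a topology \<Rightarrow> ('a \<Rightarrow> real) set" where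
  "RUCB G T = {f \<in> extensional (carrier G).
     bounded (f ` carrier G) \<and>
     (\<forall>\<epsilon>>0. \<exists>U. openin T U \<and> \<one>\<^bsub>G\<^esub> \<in> U \<and>
        (\<forall>g\<in>U. \<forall>x\<in>carrier G. \<bar>f x - translate G g f x\<bar> \<le> \<epsilon>))}"

definition means :: "('a, 'b) monoid_scheme \<Rightarrow> 'a topology \<Rightarrow> (('a \<Rightarrow> real) \<Rightarrow> real) set" where
  "means G T = {\<mu> \<in> extensional (RUCB G T).
     (\<forall>f\<in>RUCB G T. \<forall>h\<in>RUCB G T. \<mu> (\<lambda>x\<in>carrier G. f x + h x) = \<mu> f + \<mu> h) \<and>
     (\<forall>c. \<forall>f\<in>RUCB G T. \<mu> (\<lambda>x\<in>carrier G. c * f x) = c * \<mu> f) \<and>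
     (\<forall>f\<in>RUCB G T. (\<forall>x\<in>carrier G. 0 \<le> f x) \<longrightarrow> 0 \<le> \<mu> f) \<and>
     \<mu> (\<lambda>x\<in>carrier G. 1) = 1}"

text \<open>The set \<open>S(G)\<close> of unital ring homomorphisms from \<open>RUCB G T\<close> to the reals.\<close>

definition characters :: "('a, 'b) monoid_scheme \<Rightarrow> 'a topology \<Rightarrow> (('a \<Rightarrow> real) \<Rightarrow> real) set" where
  "characters G T = {\<xi> \<in> extensional (RUCB G T).
     (\<forall>f\<in>RUCB G T. \<forall>h\<in>RUCB G T. \<xi> (\<lambda>x\<in>carrier G. f x + h x) = \<xi> f + \<xi> h) \<and>
     (\<forall>f\<in>RUCB G T. \<forall>h\<in>RUCB G T. \<xi> (\<lambda>x\<in>carrier G. f x * h x) = \<xi> f * \<xi> h) \<and>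
     \<xi> (\<lambda>x\<in>carrier G. 1) = 1}"

text \<open>
  The weak-* topology on \<open>S(G)\<close>: the topology of pointwise convergence on \<open>RUCB G T\<close>.
\<close>

definition characters_topology ::
    "('a, 'b) monoid_scheme \<Rightarrow> 'a topology \<Rightarrow> (('a \<Rightarrow> real) \<Rightarrow> real) topology" where
  "characters_topology G T =
     subtopology (product_topology (\<lambda>_. euclideanreal) (RUCB G T)) (characters G T)"

definition char_action ::
    "('a, 'b) monoid_scheme \<Rightarrow> 'a topology \<Rightarrow> 'a \<Rightarrow> (('a \<Rightarrow> real) \<Rightarrow> real) \<Rightarrow> ('a \<Rightarrow> real) \<Rightarrow> real" where
  "char_action G T g \<xi> = (\<lambda>f\<in>RUCB G T. \<xi> (translate G g f))"

definition invariant_set ::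
    "('a, 'b) monoid_scheme \<Rightarrow> 'a topology \<Rightarrow> (('a \<Rightarrow> real) \<Rightarrow> real) set \<Rightarrow> bool" where
  "invariant_set G T A \<longleftrightarrow> (\<forall>g\<in>carrier G. \<forall>\<xi>\<in>A. char_action G T g \<xi> \<in> A)"

definition Phi ::
    "('a, 'b) monoid_scheme \<Rightarrow> (('a \<Rightarrow> real) \<Rightarrow> real) \<Rightarrow> ('a \<Rightarrow> real) \<Rightarrow> 'a \<Rightarrow> real" where
  "Phi G \<nu> f = (\<lambda>g\<in>carrier G. \<nu> (translate G g f))"

definition conv ::
    "('a, 'b) monoid_scheme \<Rightarrow> 'a topology \<Rightarrow> (('a \<Rightarrow> real) \<Rightarrow> real) \<Rightarrow> (('a \<Rightarrow> real) \<Rightarrow> real)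
      \<Rightarrow> ('a \<Rightarrow> real) \<Rightarrow> real" where
  "conv G T \<mu> \<nu> = compose (RUCB G T) \<mu> (Phi G \<nu>)"

text \<open>The function \<open>f\<^sub>n\<^sub>,\<^sub>n\<close> on the \<open>n\<close>-th power of \<open>G\<close>.\<close>

definition coord_average ::
    "('a, 'b) monoid_scheme \<Rightarrow> nat \<Rightarrow> ('a \<Rightarrow> real) \<Rightarrow> (nat \<Rightarrow> 'a) \<Rightarrow> real" where
  "coord_average G n f = (\<lambda>x\<in>carrier (power_group G n). 1 / real n * (\<Sum>j=1..n. f (x j)))"

end

theory Submission
  imports Defs
begin

text \<open>
  By compactness of \<open>S(G)\<close> there is \<open>f\<close> with values in \<open>[0, 1]\<close> such that \<open>\<xi> f = 1\<close> on the first
  closed invariant set and \<open>\<eta> f = 0\<close> on the second.  Fix \<open>\<xi>\<close>, \<open>\<eta>\<close> in these sets and let \<open>\<nu>\<close> be the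
  mean of their images under the diagonal embedding \<open>G \<rightarrow> G\<^sup>n\<close>.  Restricted to the diagonal, a
  translate of \<open>f\<^sub>n\<^sub>,\<^sub>n\<close> is an average of translates of \<open>f\<close>, on which \<open>\<xi>\<close> is \<open>1\<close> and \<open>\<eta>\<close> is \<open>0\<close> by
  invariance.  Hence \<open>\<nu>\<close> gives every translate of \<open>\<phi> \<circ> f\<^sub>n\<^sub>,\<^sub>n\<close> the value \<open>(\<phi> 1 + \<phi> 0) / 2\<close>, and so
  does \<open>\<mu>\<nu>\<close>: the mean of \<open>f\<^sub>n\<^sub>,\<^sub>n\<close> is \<open>1/2\<close> and its variance \<open>1/4\<close>.
\<close>

section \<open>Ring endomorphisms of the reals\<close>

text \<open>Nonnegative reals are squares, so \<open>\<phi>\<close> preserves the order; it also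
  fixes the integers, and the Archimedean property then pins it down. This is how characters, which
  are only ring homomorphisms by definition, acquire real homogeneity.\<close>

lemma real_ring_hom_eq_id:
  fixes \<phi> :: "real \<Rightarrow> real"
  assumes add: "\<And>x y. \<phi> (x + y) = \<phi> x + \<phi> y"
    and mult: "\<And>x y. \<phi> (x * y) = \<phi> x * \<phi> y"
    and one: "\<phi> 1 = 1"
  shows "\<phi> c = c"
proof -
  have zero: "\<phi> 0 = 0"
    using add[of 0 0] by simp
  have nonneg: "0 \<le> \<phi> x" if "0 \<le> x" for x
    using mult[of "sqrt x" "sqrt x"] that by simp
  have mono: "\<phi> x \<le> \<phi> y" if "x \<le> y" for x y
    using nonneg[of "y - x"] add[of x "y - x"] that by simp
  have minus: "\<phi> (- x) = - \<phi> x" for x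
    using add[of x "- x"] zero by simp
  have nat: "\<phi> (of_nat n) = of_nat n" for n
    by (induction n) (simp_all add: zero add one)
  have int: "\<phi> (of_int k) = of_int k" for k
    by (cases k rule: int_cases2) (simp_all add: nat minus)
  have "real n * \<bar>\<phi> c - c\<bar> \<le> 1" for n
  proof -
    \<comment> \<open>By monotonicity \<open>\<phi> (real n * c)\<close>, which is
      \<open>real n * \<phi> c\<close>, lies between the same consecutive integers \<open>?k\<close>
      and \<open>?k + 1\<close> as \<open>real n * c\<close> itself.\<close>
    let ?k = "\<lfloor>real n * c\<rfloor>"
    have "of_int ?k \<le> \<phi> (real n * c)"
      using mono[of "of_int ?k" "real n * c"] int[of ?k] by simp
    moreover have "\<phi> (real n * c) \<le> of_int (?k + 1)"
      using mono[of "real n * c" "of_int (?k + 1)"] int[of "?k + 1"] by linarith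
    ultimately have "\<bar>real n * \<phi> c - real n * c\<bar> \<le> 1"
      using mult[of "real n" c] nat[of n] by (simp add: abs_le_iff) linarith
    then show ?thesis
      by (simp add: abs_mult flip: right_diff_distrib)
  qed
  then have "\<bar>\<phi> c - c\<bar> \<le> 0"
    using reals_Archimedean3[of "\<bar>\<phi> c - c\<bar>"] by (meson not_le)
  then show ?thesis
    by simp
qed

section \<open>The algebra RUCB(G): closure properties\<close>

context topological_group
begin

lemma openin_subset_carrier: "openin T U \<Longrightarrow> U \<subseteq> carrier G"
  using openin_subset topspace_eq_carrier by blast

lemma translate_apply: "x \<in> carrier G \<Longrightarrow> translate G g f x = f (g \<otimes> x)"
  by (simp add: translate_def compose_def)

lemma RUCB_I:
  assumes "f \<in> extensional (carrier G)" "bounded (f ` carrier G)"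
    and "\<And>\<epsilon>. \<epsilon> > 0 \<Longrightarrow> \<exists>U. openin T U \<and> \<one> \<in> U \<and>
      (\<forall>g\<in>U. \<forall>x\<in>carrier G. \<bar>f x - f (g \<otimes> x)\<bar> \<le> \<epsilon>)"
  shows "f \<in> RUCB G T"
  using assms by (simp add: RUCB_def translate_apply)

lemma RUCB_E:
  assumes "f \<in> RUCB G T" "\<epsilon> > 0"
  obtains U where "openin T U" "\<one> \<in> U"
    "\<And>g x. g \<in> U \<Longrightarrow> x \<in> carrier G \<Longrightarrow> \<bar>f x - f (g \<otimes> x)\<bar> \<le> \<epsilon>"
  using assms by (auto simp: RUCB_def translate_apply)

lemma RUCB_eqI:
  assumes "f \<in> RUCB G T" "h \<in> RUCB G T" "\<And>x. x \<in> carrier G \<Longrightarrow> f x = h x"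
  shows "f = h"
  using assms by (auto simp: RUCB_def intro: extensionalityI)

lemma RUCB_bounded:
  assumes "f \<in> RUCB G T"
  obtains C where "\<And>x. x \<in> carrier G \<Longrightarrow> \<bar>f x\<bar> \<le> C"
  using assms unfolding RUCB_def bounded_iff by (auto simp del: abs_le_iff) blast

text \<open>The pairs \<open>(f x, h x)\<close> stay in a compact set, and there
  \<open>\<phi>\<close> is bounded and uniformly continuous. Sums, products, square roots and
  truncations are all covered by this one argument.\<close>

lemma RUCB_comp2:
  assumes f: "f \<in> RUCB G T" and h: "h \<in> RUCB G T"
    and \<phi>: "continuous_on UNIV (\<lambda>p. \<phi> (fst p) (snd p))"
  shows "(\<lambda>x\<in>carrier G. \<phi> (f x) (h x) :: real) \<in> RUCB G T" (is "?k \<in> _")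
proof -
  define K where "K = closure (f ` carrier G) \<times> closure (h ` carrier G)"
  have K: "(f x, h x) \<in> K" if "x \<in> carrier G" for x
    using that closure_subset by (fastforce simp: K_def)
  have "compact K"
    using f h by (auto simp: K_def RUCB_def intro!: compact_Times)
  moreover have \<phi>K: "continuous_on K (\<lambda>p. \<phi> (fst p) (snd p))"
    using \<phi> continuous_on_subset by blast
  ultimately have uc: "uniformly_continuous_on K (\<lambda>p. \<phi> (fst p) (snd p))"
    and bd: "bounded ((\<lambda>p. \<phi> (fst p) (snd p)) ` K)"
    using compact_uniformly_continuous compact_continuous_image compact_imp_bounded by blast+
  have "?k ` carrier G \<subseteq> (\<lambda>p. \<phi> (fst p) (snd p)) ` K"
    using K by force
  then have "bounded (?k ` carrier G)"
    using bd bounded_subset by blast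
  moreover have "\<exists>U. openin T U \<and> \<one> \<in> U \<and> (\<forall>g\<in>U. \<forall>x\<in>carrier G.
      \<bar>?k x - ?k (g \<otimes> x)\<bar> \<le> \<epsilon>)"
    if "\<epsilon> > 0" for \<epsilon>
  proof -
    obtain \<delta> where "\<delta> > 0" and \<delta>: "\<And>p q. p \<in> K \<Longrightarrow> q \<in> K \<Longrightarrow> dist q p < \<delta> \<Longrightarrow>
        dist (\<phi> (fst q) (snd q)) (\<phi> (fst p) (snd p)) < \<epsilon>"
      using uc \<open>\<epsilon> > 0\<close> unfolding uniformly_continuous_on_def by meson
    \<comment> \<open>Two deviations of at most \<open>\<delta> / 3\<close> keep the distance in the
      plane strictly below \<open>\<delta>\<close>, although RUCB supplies only weak
      inequalities.\<close>
    then have "\<delta> / 3 > 0"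
      by simp
    obtain U where U: "openin T U" "\<one> \<in> U"
        "\<And>g x. g \<in> U \<Longrightarrow> x \<in> carrier G \<Longrightarrow> \<bar>f x - f (g \<otimes> x)\<bar> \<le> \<delta> / 3"
      using RUCB_E[OF f \<open>\<delta> / 3 > 0\<close>] by blast
    obtain V where V: "openin T V" "\<one> \<in> V"
        "\<And>g x. g \<in> V \<Longrightarrow> x \<in> carrier G \<Longrightarrow> \<bar>h x - h (g \<otimes> x)\<bar> \<le> \<delta> / 3"
      using RUCB_E[OF h \<open>\<delta> / 3 > 0\<close>] by blast
    have "\<bar>?k x - ?k (g \<otimes> x)\<bar> \<le> \<epsilon>"
      if g: "g \<in> U \<inter> V" and x: "x \<in> carrier G" for g x
    proof -
      have gx: "g \<otimes> x \<in> carrier G"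
        using g x U(1) openin_subset_carrier by blast
      have "\<bar>f x - f (g \<otimes> x)\<bar> \<le> \<delta> / 3" "\<bar>h x - h (g \<otimes> x)\<bar> \<le> \<delta> / 3"
        using U(3) V(3) g x by auto
      then have "dist (f x, h x) (f (g \<otimes> x), h (g \<otimes> x)) < \<delta>"
        using sqrt_sum_squares_le_sum_abs[of "f x - f (g \<otimes> x)" "h x - h (g \<otimes> x)"] \<open>\<delta> > 0\<close>
        by (simp add: dist_prod_def dist_real_def)
      from \<delta>[OF K[OF gx] K[OF x] this] show ?thesis
        using x gx by (simp add: dist_real_def)
    qed
    with U(1,2) V(1,2) show ?thesis
      by (intro exI[of _ "U \<inter> V"] conjI ballI openin_Int IntI)
  qed
  ultimately show ?thesis
    by (intro RUCB_I restrict_extensional)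
qed

lemma RUCB_comp:
  assumes "f \<in> RUCB G T" "continuous_on UNIV \<phi>"
  shows "(\<lambda>x\<in>carrier G. \<phi> (f x) :: real) \<in> RUCB G T"
  using RUCB_comp2[OF assms(1) assms(1), of "\<lambda>s t. \<phi> s"] assms(2)
  by (simp add: continuous_on_compose2[OF assms(2)] continuous_on_fst)

lemma RUCB_const [simp, intro]: "(\<lambda>x\<in>carrier G. c) \<in> RUCB G T"
proof (rule RUCB_I)
  have "openin T (carrier G)"
    using openin_topspace[of T] by (simp add: topspace_eq_carrier)
  then show "\<exists>U. openin T U \<and> \<one> \<in> U \<and> (\<forall>g\<in>U. \<forall>x\<in>carrier G.
      \<bar>(\<lambda>x\<in>carrier G. c) x - (\<lambda>x\<in>carrier G. c) (g \<otimes> x)\<bar> \<le> \<epsilon>)" if "\<epsilon> > 0" for \<epsilon>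
    using that by (intro exI[of _ "carrier G"]) auto
qed (auto simp: bounded_iff)

lemma RUCB_add:
  "f \<in> RUCB G T \<Longrightarrow> h \<in> RUCB G T \<Longrightarrow> (\<lambda>x\<in>carrier G. f x + h x) \<in> RUCB G T"
  by (intro RUCB_comp2 continuous_intros)

lemma RUCB_mult:
  "f \<in> RUCB G T \<Longrightarrow> h \<in> RUCB G T \<Longrightarrow> (\<lambda>x\<in>carrier G. f x * h x) \<in> RUCB G T"
  by (intro RUCB_comp2 continuous_intros)

lemma RUCB_sum:
  assumes "finite J" "\<And>j. j \<in> J \<Longrightarrow> F j \<in> RUCB G T"
  shows "(\<lambda>x\<in>carrier G. \<Sum>j\<in>J. F j x) \<in> RUCB G T"
  using assms
proof (induction J rule: finite_induct)
  case empty
  show ?case by (simp only: sum.empty RUCB_const)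
next
  case (insert i J)
  have eq: "(\<lambda>x\<in>carrier G. F i x + (\<lambda>x\<in>carrier G. \<Sum>j\<in>J. F j x) x) =
      (\<lambda>x\<in>carrier G. \<Sum>j\<in>insert i J. F j x)"
    using insert.hyps by (intro restrict_ext) simp
  show ?case
    unfolding eq[symmetric] using insert by (intro RUCB_add) auto
qed

text \<open>Since \<open>p\<close> turns translation by \<open>g\<close> into translation by
  \<open>p g\<close>, the preimage under \<open>p\<close> of a neighborhood that works for
  \<open>f\<close> works for the pullback. It is applied to the diagonal embedding and to the
  coordinate projections.\<close>

lemma RUCB_pullback:
  assumes "topological_group H S" and cont: "continuous_map T S p" and hom: "p \<in> hom G H"
    and f: "f \<in> RUCB H S"
  shows "(\<lambda>x\<in>carrier G. f (p x)) \<in> RUCB G T" (is "?k \<in> _")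
proof -
  interpret H: topological_group H S by fact
  have p: "p x \<in> carrier H" if "x \<in> carrier G" for x
    using hom that by (auto simp: hom_def)
  have pm: "p (x \<otimes> y) = p x \<otimes>\<^bsub>H\<^esub> p y" if "x \<in> carrier G" "y \<in> carrier G" for x y
    using hom that by (auto simp: hom_def)
  have p1: "p \<one> = \<one>\<^bsub>H\<^esub>"
    using hom hom_one is_group H.is_group by blast
  have "?k ` carrier G \<subseteq> f ` carrier H"
    using p by auto
  then have "bounded (?k ` carrier G)"
    using f bounded_subset unfolding RUCB_def by blast
  moreover have "\<exists>U. openin T U \<and> \<one> \<in> U \<and> (\<forall>g\<in>U. \<forall>x\<in>carrier G.
      \<bar>?k x - ?k (g \<otimes> x)\<bar> \<le> \<epsilon>)"
    if "\<epsilon> > 0" for \<epsilon>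
  proof -
    obtain V where V: "openin S V" "\<one>\<^bsub>H\<^esub> \<in> V"
        "\<And>g x. g \<in> V \<Longrightarrow> x \<in> carrier H \<Longrightarrow> \<bar>f x - f (g \<otimes>\<^bsub>H\<^esub> x)\<bar> \<le> \<epsilon>"
      using H.RUCB_E[OF f \<open>\<epsilon> > 0\<close>] by blast
    let ?U = "{x \<in> topspace T. p x \<in> V}"
    have "openin T ?U"
      using cont V(1) openin_continuous_map_preimage by blast
    moreover have "\<one> \<in> ?U"
      using V(2) p1 by (simp add: topspace_eq_carrier)
    moreover have "\<bar>?k x - ?k (g \<otimes> x)\<bar> \<le> \<epsilon>" if "g \<in> ?U" "x \<in> carrier G" for g x
      using V(3)[of "p g" "p x"] that p by (simp add: pm topspace_eq_carrier)
    ultimately show ?thesis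
      by (intro exI[of _ ?U] conjI ballI)
  qed
  ultimately show ?thesis
    by (intro RUCB_I restrict_extensional)
qed

lemma continuous_map_left_mult:
  "g \<in> carrier G \<Longrightarrow> continuous_map T T (\<lambda>x. g \<otimes> x)"
  using continuous_map_compose[OF _ continuous_mult, of T "\<lambda>x. (g, x)"]
  by (simp add: o_def continuous_map_pairedI topspace_eq_carrier)

lemma continuous_map_right_mult:
  "g \<in> carrier G \<Longrightarrow> continuous_map T T (\<lambda>x. x \<otimes> g)"
  using continuous_map_compose[OF _ continuous_mult, of T "\<lambda>x. (x, g)"]
  by (simp add: o_def continuous_map_pairedI topspace_eq_carrier)

text \<open>Left translation by \<open>g\<close> does not commute with left translation by
  \<open>k\<close>, but it does so up to conjugation: \<open>g \<otimes> (k \<otimes> x)\<close> is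
  \<open>(g \<otimes> k \<otimes> inv g) \<otimes> (g \<otimes> x)\<close>. Conjugation by
  \<open>g\<close> is continuous and fixes the identity, so a neighborhood for \<open>f\<close> can
  be pulled back along it.\<close>

lemma RUCB_translate:
  assumes f: "f \<in> RUCB G T" and g: "g \<in> carrier G"
  shows "translate G g f \<in> RUCB G T"
proof -
  have "translate G g f ` carrier G \<subseteq> f ` carrier G"
    using g by (auto simp: translate_apply)
  then have "bounded (translate G g f ` carrier G)"
    using f bounded_subset unfolding RUCB_def by blast
  moreover have "translate G g f \<in> extensional (carrier G)"
    by (simp add: translate_def compose_extensional)
  moreover have "\<exists>U. openin T U \<and> \<one> \<in> U \<and> (\<forall>k\<in>U. \<forall>x\<in>carrier G.
      \<bar>translate G g f x - translate G g f (k \<otimes> x)\<bar> \<le> \<epsilon>)"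
    if "\<epsilon> > 0" for \<epsilon>
  proof -
    obtain V where V: "openin T V" "\<one> \<in> V"
        "\<And>k x. k \<in> V \<Longrightarrow> x \<in> carrier G \<Longrightarrow> \<bar>f x - f (k \<otimes> x)\<bar> \<le> \<epsilon>"
      using RUCB_E[OF f \<open>\<epsilon> > 0\<close>] by blast
    let ?c = "\<lambda>k. g \<otimes> k \<otimes> inv g"
    let ?U = "{k \<in> topspace T. ?c k \<in> V}"
    have "continuous_map T T ?c"
      using continuous_map_compose[OF continuous_map_left_mult continuous_map_right_mult] g
      by (simp add: o_def)
    then have "openin T ?U"
      using V(1) openin_continuous_map_preimage by blast
    moreover have "\<one> \<in> ?U"
      using V(2) g by (simp add: topspace_eq_carrier)
    moreover have "\<bar>translate G g f x - translate G g f (k \<otimes> x)\<bar> \<le> \<epsilon>"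
      if "k \<in> ?U" "x \<in> carrier G" for k x
    proof -
      have k: "k \<in> carrier G" "?c k \<in> V"
        using that by (auto simp: topspace_eq_carrier)
      have "?c k \<otimes> (g \<otimes> x) = g \<otimes> (k \<otimes> x)"
        using k(1) g that(2) by (simp add: m_assoc flip: m_assoc[of "inv g" g x])
      then show ?thesis
        using V(3)[OF k(2), of "g \<otimes> x"] g k(1) that(2) by (simp add: translate_apply)
    qed
    ultimately show ?thesis
      by (intro exI[of _ ?U] conjI ballI)
  qed
  ultimately show ?thesis
    by (intro RUCB_I)
qed

section \<open>Characters: positivity and continuous functional calculus\<close>

context
  fixes \<xi> assumes \<xi>: "\<xi> \<in> characters G T"
begin

lemma character_add:
  "f \<in> RUCB G T \<Longrightarrow> h \<in> RUCB G T \<Longrightarrow> \<xi> (\<lambda>x\<in>carrier G. f x + h x) = \<xi> f + \<xi> h"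
  using \<xi> by (simp add: characters_def)

lemma character_mult:
  "f \<in> RUCB G T \<Longrightarrow> h \<in> RUCB G T \<Longrightarrow> \<xi> (\<lambda>x\<in>carrier G. f x * h x) = \<xi> f * \<xi> h"
  using \<xi> by (simp add: characters_def)

text \<open>Restricted to the constant functions, \<open>\<xi>\<close> is a unital ring endomorphism
  of the reals, hence the identity.\<close>

lemma character_const: "\<xi> (\<lambda>x\<in>carrier G. c) = c"
proof (rule real_ring_hom_eq_id)
  fix a b :: real
  have "(\<lambda>x\<in>carrier G. (\<lambda>x\<in>carrier G. a) x + (\<lambda>x\<in>carrier G. b) x) = (\<lambda>x\<in>carrier G. a + b)"
    "(\<lambda>x\<in>carrier G. (\<lambda>x\<in>carrier G. a) x * (\<lambda>x\<in>carrier G. b) x) = (\<lambda>x\<in>carrier G. a * b)"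
    by (auto cong: restrict_cong)
  then show "\<xi> (\<lambda>x\<in>carrier G. a + b) = \<xi> (\<lambda>x\<in>carrier G. a) + \<xi> (\<lambda>x\<in>carrier G. b)"
    "\<xi> (\<lambda>x\<in>carrier G. a * b) = \<xi> (\<lambda>x\<in>carrier G. a) * \<xi> (\<lambda>x\<in>carrier G. b)"
    using character_add[of "\<lambda>x\<in>carrier G. a" "\<lambda>x\<in>carrier G. b"]
      character_mult[of "\<lambda>x\<in>carrier G. a" "\<lambda>x\<in>carrier G. b"] by auto
next
  show "\<xi> (\<lambda>x\<in>carrier G. 1) = 1"
    using \<xi> by (simp add: characters_def)
qed

text \<open>The difference of \<open>f\<close> and \<open>c\<close> is a square in the algebra, so a
  character maps it to a square of a real number.\<close>

lemma character_ge:
  assumes f: "f \<in> RUCB G T" and c: "\<And>x. x \<in> carrier G \<Longrightarrow> c \<le> f x"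
  shows "c \<le> \<xi> f"
proof -
  \<comment> \<open>In HOL \<open>sqrt\<close> is extended to negative numbers as an odd function
    and is continuous on the whole line, so \<open>RUCB_comp\<close> applies directly.\<close>
  let ?r = "\<lambda>x\<in>carrier G. sqrt (f x - c)"
  have r: "?r \<in> RUCB G T"
    using f by (intro RUCB_comp continuous_intros)
  have eq: "(\<lambda>x\<in>carrier G. (\<lambda>x\<in>carrier G. ?r x * ?r x) x + (\<lambda>x\<in>carrier G. c) x) = f"
    using f c by (intro RUCB_eqI RUCB_add RUCB_mult r RUCB_const) auto
  have "\<xi> f = \<xi> ?r * \<xi> ?r + c"
    using character_add[OF RUCB_mult[OF r r] RUCB_const, of c]
    unfolding character_mult[OF r r] character_const eq .
  then show ?thesis
    by simp
qed

lemma character_square_dist: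
  assumes f: "f \<in> RUCB G T"
  shows "\<xi> (\<lambda>x\<in>carrier G. (f x - c)\<^sup>2) = (\<xi> f - c)\<^sup>2"
proof -
  let ?h = "\<lambda>x\<in>carrier G. f x + (\<lambda>x\<in>carrier G. - c) x"
  have h: "?h \<in> RUCB G T"
    using f by (intro RUCB_add RUCB_const)
  have "(\<lambda>x\<in>carrier G. (f x - c)\<^sup>2) = (\<lambda>x\<in>carrier G. ?h x * ?h x)"
    by (auto simp: power2_eq_square)
  then show ?thesis
    using character_mult[OF h h] character_add[OF f RUCB_const, of "- c"] character_const[of "- c"]
    by (simp add: power2_eq_square)
qed

text \<open>
  The function \<open>(f - \<xi> f)\<^sup>2 + (h - \<xi> h)\<^sup>2 + (\<phi>(f, h) - \<xi> (\<phi>(f, h)))\<^sup>2\<close> is in the kernel of \<open>\<xi>\<close>, so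
  by positivity it is not bounded away from \<open>0\<close>.
\<close>

lemma character_comp2:
  assumes f: "f \<in> RUCB G T" and h: "h \<in> RUCB G T"
    and \<phi>: "continuous_on UNIV (\<lambda>p. \<phi> (fst p) (snd p) :: real)"
  shows "\<xi> (\<lambda>x\<in>carrier G. \<phi> (f x) (h x)) = \<phi> (\<xi> f) (\<xi> h)"
proof (rule ccontr)
  let ?k = "\<lambda>x\<in>carrier G. \<phi> (f x) (h x)"
  let ?sq = "\<lambda>f. \<lambda>x\<in>carrier G. (f x - \<xi> f)\<^sup>2"
  have k: "?k \<in> RUCB G T"
    using assms by (rule RUCB_comp2)
  assume "\<xi> ?k \<noteq> \<phi> (\<xi> f) (\<xi> h)"
  \<comment> \<open>Half the gap: whatever is within \<open>\<epsilon>\<close> of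
    \<open>\<phi> (\<xi> f) (\<xi> h)\<close> is at least \<open>\<epsilon>\<close> away from
    \<open>\<xi> ?k\<close>.\<close>
  define \<epsilon> where "\<epsilon> = \<bar>\<xi> ?k - \<phi> (\<xi> f) (\<xi> h)\<bar> / 2"
  then have "\<epsilon> > 0"
    using \<open>\<xi> ?k \<noteq> _\<close> by simp
  then obtain \<delta> where "\<delta> > 0" and \<delta>: "\<And>p. dist p (\<xi> f, \<xi> h) < \<delta> \<Longrightarrow>
      dist (\<phi> (fst p) (snd p)) (\<phi> (\<xi> f) (\<xi> h)) < \<epsilon>"
    using \<phi> unfolding continuous_on_iff by (metis UNIV_I fst_conv snd_conv)
  \<comment> \<open>A lower bound for the sum of squares: if \<open>(f x, h x)\<close> is within
    \<open>\<delta>\<close> of \<open>(\<xi> f, \<xi> h)\<close>, the third square is at least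
    \<open>\<epsilon>\<^sup>2\<close>; otherwise the first two together are at least
    \<open>\<delta>\<^sup>2\<close>.\<close>
  define m where "m = min (\<delta>\<^sup>2) (\<epsilon>\<^sup>2)"
  have sq: "?sq u \<in> RUCB G T" if "u \<in> RUCB G T" for u
    using that by (intro RUCB_comp continuous_intros)
  let ?s = "\<lambda>x\<in>carrier G. (\<lambda>x\<in>carrier G. ?sq f x + ?sq h x) x + ?sq ?k x"
  have s: "?s \<in> RUCB G T"
    by (intro RUCB_add sq f h k)
  have "\<xi> ?s = 0"
    unfolding character_add[OF RUCB_add[OF sq[OF f] sq[OF h]] sq[OF k]]
      character_add[OF sq[OF f] sq[OF h]] character_square_dist[OF f] character_square_dist[OF h]
      character_square_dist[OF k] by simp
  moreover have "m \<le> ?s x" if x: "x \<in> carrier G" for x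
  proof (cases "dist (f x, h x) (\<xi> f, \<xi> h) < \<delta>")
    case True
    then have "\<bar>\<phi> (f x) (h x) - \<phi> (\<xi> f) (\<xi> h)\<bar> < \<epsilon>"
      using \<delta>[of "(f x, h x)"] by (simp add: dist_real_def)
    then have "\<epsilon> \<le> \<bar>?k x - \<xi> ?k\<bar>"
      using x unfolding \<epsilon>_def by (simp add: abs_if split: if_splits)
    then have "\<epsilon>\<^sup>2 \<le> (?k x - \<xi> ?k)\<^sup>2"
      using \<open>\<epsilon> > 0\<close> abs_le_square_iff[of \<epsilon> "?k x - \<xi> ?k"] by simp
    then have "m \<le> (?k x - \<xi> ?k)\<^sup>2"
      by (simp add: m_def)
    moreover have "0 \<le> (f x - \<xi> f)\<^sup>2" "0 \<le> (h x - \<xi> h)\<^sup>2"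
      by simp_all
    ultimately have "m \<le> (f x - \<xi> f)\<^sup>2 + (h x - \<xi> h)\<^sup>2 + (?k x - \<xi> ?k)\<^sup>2"
      by linarith
    then show ?thesis
      using x by simp
  next
    case False
    then have "\<delta> \<le> sqrt ((f x - \<xi> f)\<^sup>2 + (h x - \<xi> h)\<^sup>2)"
      by (simp add: dist_prod_def dist_real_def)
    then have "\<delta>\<^sup>2 \<le> (f x - \<xi> f)\<^sup>2 + (h x - \<xi> h)\<^sup>2"
      using \<open>\<delta> > 0\<close> by (simp add: real_le_rsqrt sqrt_ge_absD)
    moreover have "0 \<le> (?k x - \<xi> ?k)\<^sup>2"
      by simp
    moreover have "m \<le> \<delta>\<^sup>2"
      by (simp add: m_def)
    ultimately have "m \<le> (f x - \<xi> f)\<^sup>2 + (h x - \<xi> h)\<^sup>2 + (?k x - \<xi> ?k)\<^sup>2"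
      by linarith
    then show ?thesis
      using x by simp
  qed
  ultimately have "m \<le> 0"
    using character_ge[OF s, of m] by simp
  then show False
    using \<open>\<delta> > 0\<close> \<open>\<epsilon> > 0\<close> by (simp add: m_def min_def split: if_splits)
qed

lemma character_comp:
  assumes "f \<in> RUCB G T" "continuous_on UNIV \<phi>"
  shows "\<xi> (\<lambda>x\<in>carrier G. \<phi> (f x) :: real) = \<phi> (\<xi> f)"
  using character_comp2[OF assms(1) assms(1), of "\<lambda>s t. \<phi> s"]
  by (simp add: continuous_on_compose2[OF assms(2)] continuous_on_fst)

lemma character_sum:
  assumes "finite J" "\<And>j. j \<in> J \<Longrightarrow> F j \<in> RUCB G T"
  shows "\<xi> (\<lambda>x\<in>carrier G. \<Sum>j\<in>J. F j x) = (\<Sum>j\<in>J. \<xi> (F j))"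
  using assms
proof (induction J rule: finite_induct)
  case empty
  show ?case by (simp only: sum.empty character_const)
next
  case (insert i J)
  have eq: "(\<lambda>x\<in>carrier G. F i x + (\<lambda>x\<in>carrier G. \<Sum>j\<in>J. F j x) x) =
      (\<lambda>x\<in>carrier G. \<Sum>j\<in>insert i J. F j x)"
    using insert.hyps by (intro restrict_ext) simp
  have "\<xi> (\<lambda>x\<in>carrier G. \<Sum>j\<in>J. F j x) = (\<Sum>j\<in>J. \<xi> (F j))"
    using insert.IH insert.prems by blast
  then show ?case
    unfolding eq[symmetric] using insert.hyps insert.prems
    by (subst character_add) (auto intro: RUCB_sum)
qed

end

text \<open>Positivity applied to \<open>f\<close> and to its negative. The bound does not depend on
  \<open>\<xi>\<close>, which places S(G) inside a product of compact intervals.\<close>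

lemma character_abs_le:
  assumes \<xi>: "\<xi> \<in> characters G T" and f: "f \<in> RUCB G T"
    and C: "\<And>x. x \<in> carrier G \<Longrightarrow> \<bar>f x\<bar> \<le> C"
  shows "\<bar>\<xi> f\<bar> \<le> C"
proof -
  have "\<xi> (\<lambda>x\<in>carrier G. - f x) = - \<xi> f"
    using \<xi> f by (intro character_comp continuous_intros)
  moreover have "- C \<le> \<xi> (\<lambda>x\<in>carrier G. - f x)"
    using f C by (intro character_ge[OF \<xi>] RUCB_comp continuous_intros) (auto simp: abs_le_iff)
  moreover have "- C \<le> \<xi> f"
    using f C by (intro character_ge[OF \<xi>]) (auto simp: abs_le_iff minus_le_iff)
  ultimately show ?thesis
    by linarith
qed

section \<open>Compactness of S(G)\<close>

lemma topspace_characters_topology: "topspace (characters_topology G T) = characters G T"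
  by (auto simp: characters_topology_def characters_def PiE_def)

text \<open>Each defining equation compares two continuous functions of \<open>\<xi>\<close>, built
  from evaluations, with values in a Hausdorff space.\<close>

lemma closedin_characters:
  "closedin (product_topology (\<lambda>_. euclideanreal) (RUCB G T)) (characters G T)"
proof -
  let ?X = "product_topology (\<lambda>_. euclideanreal) (RUCB G T)"
  let ?add = "\<lambda>f h. {\<xi> \<in> topspace ?X. \<xi> (\<lambda>x\<in>carrier G. f x + h x) = \<xi> f + \<xi> h}"
  let ?mult = "\<lambda>f h. {\<xi> \<in> topspace ?X. \<xi> (\<lambda>x\<in>carrier G. f x * h x) = \<xi> f * \<xi> h}"
  let ?one = "{\<xi> \<in> topspace ?X. \<xi> (\<lambda>x\<in>carrier G. 1) = 1}"
  have eq: "characters G T = ?one \<inter> (\<Inter>f\<in>RUCB G T. \<Inter>h\<in>RUCB G T. ?add f h \<inter> ?mult f h)"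
    unfolding characters_def by (auto simp: PiE_def)
  have add: "closedin ?X (?add f h)" if "f \<in> RUCB G T" "h \<in> RUCB G T" for f h
    by (intro closedin_continuous_maps_eq[where Y = euclideanreal] continuous_map_add
        continuous_map_product_projection RUCB_add that Hausdorff_space_euclidean)
  have mult: "closedin ?X (?mult f h)" if "f \<in> RUCB G T" "h \<in> RUCB G T" for f h
    by (intro closedin_continuous_maps_eq[where Y = euclideanreal] continuous_map_real_mult
        continuous_map_product_projection RUCB_mult that Hausdorff_space_euclidean)
  have one: "closedin ?X ?one"
    by (intro closedin_continuous_maps_eq[where Y = euclideanreal]
        continuous_map_product_projection RUCB_const Hausdorff_space_euclidean) simp
  \<comment> \<open>An intersection over an empty index set would be \<open>UNIV\<close>, so
    \<open>closedin_INT\<close> asks for a nonempty one.\<close>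
  have "RUCB G T \<noteq> {}"
    using RUCB_const by blast
  then show ?thesis
    unfolding eq by (intro closedin_Int closedin_INT one add mult)
qed

text \<open>Tychonoff: the characters form a closed subset of a product of compact
  intervals.\<close>

lemma compact_space_characters: "compact_space (characters_topology G T)"
proof -
  have "\<exists>C. \<forall>x\<in>carrier G. \<bar>f x\<bar> \<le> C" if "f \<in> RUCB G T" for f
    using RUCB_bounded[OF that] by metis
  then obtain C where C: "\<And>f x. f \<in> RUCB G T \<Longrightarrow> x \<in> carrier G \<Longrightarrow> \<bar>f x\<bar> \<le> C f"
    by metis
  have "compactin (product_topology (\<lambda>_. euclideanreal) (RUCB G T))
      (PiE (RUCB G T) (\<lambda>f. {- C f..C f}))"
    by (simp add: compactin_PiE)
  moreover have "characters G T \<subseteq> PiE (RUCB G T) (\<lambda>f. {- C f..C f})"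
  proof
    fix \<xi> assume \<xi>: "\<xi> \<in> characters G T"
    then have "\<bar>\<xi> f\<bar> \<le> C f" if "f \<in> RUCB G T" for f
      using character_abs_le C that by blast
    then show "\<xi> \<in> PiE (RUCB G T) (\<lambda>f. {- C f..C f})"
      using \<xi> by (auto simp: characters_def PiE_def abs_le_iff minus_le_iff)
  qed
  ultimately have "compactin (product_topology (\<lambda>_. euclideanreal) (RUCB G T)) (characters G T)"
    using closedin_characters closed_compactin by blast
  then show ?thesis
    by (simp add: characters_topology_def compact_space_subtopology)
qed

section \<open>Separation of closed subsets of S(G) by elements of RUCB(G)\<close>

text \<open>A basic neighborhood of \<open>\<eta>\<close> missing \<open>A\<close> restricts only
  finitely many coordinates \<open>f\<close>. The sum \<open>h\<close> of the squared deviations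
  from \<open>\<eta> f\<close>, each scaled by the radius \<open>e f\<close>, is sent to 0 by
  \<open>\<eta>\<close> and to at least 1 by every member of \<open>A\<close>. Truncating
  \<open>h\<close> yields \<open>k\<close>.\<close>

lemma separate_point_from_closed:
  assumes A: "closedin (characters_topology G T) A"
    and \<eta>: "\<eta> \<in> characters G T" "\<eta> \<notin> A"
  obtains k U where "k \<in> RUCB G T" "openin (characters_topology G T) U" "\<eta> \<in> U"
    "\<And>\<xi>. \<xi> \<in> A \<Longrightarrow> \<xi> k = 1" "\<And>\<xi>. \<xi> \<in> U \<Longrightarrow> \<xi> k = 0"
proof -
  let ?X = "product_topology (\<lambda>_. euclideanreal) (RUCB G T)"
  have A_sub: "A \<subseteq> characters G T"
    using closedin_subset[OF A] topspace_characters_topology by simp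
  have "openin (characters_topology G T) (characters G T - A)"
    using A topspace_characters_topology by (metis openin_diff openin_topspace)
  then obtain W where W: "openin ?X W" "characters G T - A = W \<inter> characters G T"
    unfolding characters_topology_def openin_subtopology by blast
  then have "\<eta> \<in> W"
    using \<eta> by blast
  then obtain V where V: "finite {f \<in> RUCB G T. V f \<noteq> UNIV}" "\<And>f. f \<in> RUCB G T \<Longrightarrow> open (V f)"
      "\<eta> \<in> PiE (RUCB G T) V" "PiE (RUCB G T) V \<subseteq> W"
    using bspec[OF W(1)[unfolded openin_product_topology_alt] \<open>\<eta> \<in> W\<close>] by auto
  define J where "J = {f \<in> RUCB G T. V f \<noteq> UNIV}"
  have "\<exists>e>0. ball (\<eta> f) e \<subseteq> V f" if "f \<in> RUCB G T" for f
    using V(2)[OF that] PiE_mem[OF V(3) that] by (simp add: open_contains_ball)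
  then obtain e where e: "\<And>f. f \<in> RUCB G T \<Longrightarrow> 0 < e f"
      "\<And>f. f \<in> RUCB G T \<Longrightarrow> ball (\<eta> f) (e f) \<subseteq> V f"
    by metis
  define q where "q f = (\<lambda>x\<in>carrier G. ((f x - \<eta> f) / e f)\<^sup>2)" for f
  have q: "q f \<in> RUCB G T" if "f \<in> RUCB G T" for f
    unfolding q_def divide_inverse using that by (intro RUCB_comp continuous_intros)
  have q_char: "\<xi> (q f) = ((\<xi> f - \<eta> f) / e f)\<^sup>2" if "\<xi> \<in> characters G T" "f \<in> RUCB G T" for \<xi> f
    unfolding q_def divide_inverse using that by (intro character_comp continuous_intros)
  define h where "h = (\<lambda>x\<in>carrier G. \<Sum>f\<in>J. q f x)"
  have h: "h \<in> RUCB G T"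
    unfolding h_def using V(1) q by (intro RUCB_sum) (auto simp: J_def)
  have h_char: "\<xi> h = (\<Sum>f\<in>J. ((\<xi> f - \<eta> f) / e f)\<^sup>2)" if "\<xi> \<in> characters G T" for \<xi>
    unfolding h_def using V(1) q that
    by (subst character_sum) (auto simp: J_def q_char)
  have h_ge: "1 \<le> \<xi> h" if "\<xi> \<in> A" for \<xi>
  proof -
    have \<xi>: "\<xi> \<in> characters G T" "\<xi> \<notin> W"
      using that A_sub W(2) by blast+
    then have "\<xi> \<notin> PiE (RUCB G T) V"
      using V(4) by blast
    then obtain f where f: "f \<in> RUCB G T" "\<xi> f \<notin> V f"
      using \<xi>(1) by (auto simp: characters_def PiE_def)
    then have "f \<in> J" "\<xi> f \<notin> ball (\<eta> f) (e f)"
      using e(2)[OF f(1)] by (auto simp: J_def simp del: mem_ball)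
    then have "1 \<le> \<bar>(\<xi> f - \<eta> f) / e f\<bar>"
      using e(1)[OF f(1)] by (simp add: dist_real_def abs_minus_commute)
    then have "1 \<le> ((\<xi> f - \<eta> f) / e f)\<^sup>2"
      using abs_le_square_iff[of 1 "(\<xi> f - \<eta> f) / e f"] by simp
    also have "\<dots> \<le> \<xi> h"
      unfolding h_char[OF \<xi>(1)] using \<open>f \<in> J\<close> V(1)
      by (intro member_le_sum) (auto simp: J_def)
    finally show ?thesis .
  qed
  \<comment> \<open>This function is 1 from \<open>t = 1\<close> on and 0 up to
    \<open>t = 1 / 2\<close>, so \<open>k\<close> is annihilated on a whole open set around
    \<open>\<eta>\<close>.\<close>
  let ?\<phi> = "\<lambda>t. max 0 (min 1 (2 * t - 1)) :: real"
  let ?k = "\<lambda>x\<in>carrier G. ?\<phi> (h x)"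
  let ?U = "{\<xi> \<in> topspace (characters_topology G T). \<xi> h \<in> {..<1 / 2}}"
  have k_char: "\<xi> ?k = ?\<phi> (\<xi> h)" if "\<xi> \<in> characters G T" for \<xi>
    using that h by (intro character_comp continuous_intros)
  show thesis
  proof (rule that)
    show "?k \<in> RUCB G T"
      using h by (intro RUCB_comp continuous_intros)
    have "continuous_map (characters_topology G T) euclideanreal (\<lambda>\<xi>. \<xi> h)"
      unfolding characters_topology_def using h
      by (intro continuous_map_from_subtopology continuous_map_product_projection)
    then show "openin (characters_topology G T) ?U"
      by (rule openin_continuous_map_preimage) (simp add: open_openin[symmetric])
    show "\<eta> \<in> ?U"
      using \<eta>(1) h_char[OF \<eta>(1)] by (simp add: topspace_characters_topology)
    show "\<xi> ?k = 1" if "\<xi> \<in> A" for \<xi>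
      using h_ge[OF that] k_char[of \<xi>] that A_sub by (auto simp: max_def min_def)
    show "\<xi> ?k = 0" if "\<xi> \<in> ?U" for \<xi>
      using k_char[of \<xi>] that by (auto simp: topspace_characters_topology max_def min_def)
  qed
qed

text \<open>A Urysohn argument: by compactness finitely many of the open sets from
  \<open>separate_point_from_closed\<close> cover \<open>B\<close>, and the product of their
  functions is sent to 1 on \<open>A\<close> and to 0 on \<open>B\<close>, because characters are
  multiplicative.\<close>

lemma separate_closed_sets:
  assumes A: "closedin (characters_topology G T) A" and B: "closedin (characters_topology G T) B"
    and disj: "A \<inter> B = {}"
  obtains f where "f \<in> RUCB G T" "\<And>x. x \<in> carrier G \<Longrightarrow> 0 \<le> f x \<and> f x \<le> 1"
    "\<And>\<xi>. \<xi> \<in> A \<Longrightarrow> \<xi> f = 1" "\<And>\<xi>. \<xi> \<in> B \<Longrightarrow> \<xi> f = 0"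
proof -
  let ?S = "characters_topology G T"
  have sub: "A \<subseteq> characters G T" "B \<subseteq> characters G T"
    using A B closedin_subset topspace_characters_topology by blast+
  define \<U> where "\<U> = {U. openin ?S U \<and>
    (\<exists>k\<in>RUCB G T. (\<forall>\<xi>\<in>A. \<xi> k = 1) \<and> (\<forall>\<xi>\<in>U. \<xi> k = 0))}"
  have \<U>_sub: "U \<subseteq> characters G T" if "U \<in> \<U>" for U
  proof -
    have "openin ?S U"
      using that by (simp add: \<U>_def)
    then show ?thesis
      using openin_subset topspace_characters_topology by metis
  qed
  have "B \<subseteq> \<Union>\<U>"
  proof
    fix \<eta> assume "\<eta> \<in> B"
    then have "\<eta> \<in> characters G T" "\<eta> \<notin> A"
      using sub disj by blast+
    then obtain k U where "k \<in> RUCB G T" "openin ?S U" "\<eta> \<in> U"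
        "\<And>\<xi>. \<xi> \<in> A \<Longrightarrow> \<xi> k = 1" "\<And>\<xi>. \<xi> \<in> U \<Longrightarrow> \<xi> k = 0"
      using separate_point_from_closed[OF A] by metis
    then show "\<eta> \<in> \<Union>\<U>"
      unfolding \<U>_def by blast
  qed
  moreover have "compactin ?S B"
    using compact_space_characters B closedin_compact_space by blast
  ultimately obtain \<F> where \<F>: "finite \<F>" "\<F> \<subseteq> \<U>" "B \<subseteq> \<Union>\<F>"
    unfolding compactin_def by (metis (no_types, lifting) \<U>_def mem_Collect_eq)
  have "\<exists>k\<in>RUCB G T. (\<forall>\<xi>\<in>A. \<xi> k = 1) \<and> (\<forall>\<xi>\<in>\<Union>\<F>. \<xi> k = 0)"
    using \<F>(1,2)
  proof (induction \<F> rule: finite_induct)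
    case empty
    have "\<xi> (\<lambda>x\<in>carrier G. 1) = 1" if "\<xi> \<in> A" for \<xi>
      using that sub(1) by (auto simp: characters_def)
    then show ?case
      using RUCB_const[of 1] by blast
  next
    case (insert U \<F>)
    then have "\<exists>k\<in>RUCB G T. (\<forall>\<xi>\<in>A. \<xi> k = 1) \<and> (\<forall>\<xi>\<in>\<Union>\<F>. \<xi> k = 0)"
      by blast
    then obtain k where "k \<in> RUCB G T" "(\<forall>\<xi>\<in>A. \<xi> k = 1) \<and> (\<forall>\<xi>\<in>\<Union>\<F>. \<xi> k = 0)"
      by (rule bexE)
    then have k: "k \<in> RUCB G T" "\<And>\<xi>. \<xi> \<in> A \<Longrightarrow> \<xi> k = 1" "\<And>\<xi>. \<xi> \<in> \<Union>\<F> \<Longrightarrow> \<xi> k = 0"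
      by blast+
    obtain l where l: "l \<in> RUCB G T" "\<And>\<xi>. \<xi> \<in> A \<Longrightarrow> \<xi> l = 1" "\<And>\<xi>. \<xi> \<in> U \<Longrightarrow> \<xi> l = 0"
      using insert.prems unfolding \<U>_def by auto
    have "\<xi> (\<lambda>x\<in>carrier G. k x * l x) = 0" if \<xi>: "\<xi> \<in> \<Union>(insert U \<F>)" for \<xi>
    proof -
      have "\<xi> \<in> characters G T"
        using \<xi> insert.prems \<U>_sub by blast
      then have "\<xi> (\<lambda>x\<in>carrier G. k x * l x) = \<xi> k * \<xi> l"
        using k(1) l(1) by (rule character_mult)
      moreover have "\<xi> k = 0 \<or> \<xi> l = 0"
        using \<xi> k(3) l(3) by blast
      ultimately show ?thesis
        by auto
    qed
    moreover have "\<xi> (\<lambda>x\<in>carrier G. k x * l x) = 1" if "\<xi> \<in> A" for \<xi>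
      using character_mult[OF _ k(1) l(1)] that sub(1) k(2)[OF that] l(2)[OF that] by force
    ultimately show ?case
      using RUCB_mult[OF k(1) l(1)] by blast
  qed
  then obtain k where "k \<in> RUCB G T" "(\<forall>\<xi>\<in>A. \<xi> k = 1) \<and> (\<forall>\<xi>\<in>\<Union>\<F>. \<xi> k = 0)"
    by (rule bexE)
  then have k: "k \<in> RUCB G T" "\<And>\<xi>. \<xi> \<in> A \<Longrightarrow> \<xi> k = 1" "\<And>\<xi>. \<xi> \<in> B \<Longrightarrow> \<xi> k = 0"
    using \<F>(3) by blast+
  \<comment> \<open>Only the values of characters on \<open>k\<close> are controlled so far.
    Truncation forces the values of the function itself into the unit interval, and it fixes 0 and
    1.\<close>
  let ?\<phi> = "\<lambda>t. max 0 (min 1 t) :: real"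
  have "\<xi> (\<lambda>x\<in>carrier G. ?\<phi> (k x)) = ?\<phi> (\<xi> k)" if "\<xi> \<in> characters G T" for \<xi>
    using that k(1) by (intro character_comp continuous_intros)
  then have char: "\<xi> (\<lambda>x\<in>carrier G. ?\<phi> (k x)) = ?\<phi> (\<xi> k)" if "\<xi> \<in> A \<union> B" for \<xi>
    using that sub by blast
  show thesis
  proof (rule that)
    show "(\<lambda>x\<in>carrier G. ?\<phi> (k x)) \<in> RUCB G T"
      using k(1) by (intro RUCB_comp continuous_intros)
    show "\<xi> (\<lambda>x\<in>carrier G. ?\<phi> (k x)) = 1" if "\<xi> \<in> A" for \<xi>
      using char[of \<xi>] k(2)[OF that] that by simp
    show "\<xi> (\<lambda>x\<in>carrier G. ?\<phi> (k x)) = 0" if "\<xi> \<in> B" for \<xi>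
      using char[of \<xi>] k(3)[OF that] that by simp
  qed auto
qed

section \<open>Powers of the group\<close>

lemma carrier_power_group: "carrier (power_group G n) = PiE {1..n} (\<lambda>_. carrier G)"
  by (simp add: power_group_def)

lemma mult_power_group: "x \<otimes>\<^bsub>power_group G n\<^esub> y = (\<lambda>j\<in>{1..n}. x j \<otimes> y j)"
  by (simp add: power_group_def)

text \<open>Continuity of the operations is checked coordinate by coordinate. Through this lemma the
  results of the locale become available for the powers by interpretation.\<close>

lemma topological_group_power: "topological_group (power_group G n) (power_topology T n)"
proof -
  let ?I = "{1..n}"
  have grp: "group (power_group G n)"
    by (simp add: power_group_def is_group)
  have top: "topspace (power_topology T n) = carrier (power_group G n)"
    by (simp add: power_topology_def carrier_power_group topspace_eq_carrier)
  have "continuous_map (prod_topology (power_topology T n) (power_topology T n)) T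
      (\<lambda>p. fst p j \<otimes> snd p j)" if "j \<in> ?I" for j
  proof -
    have proj: "continuous_map (power_topology T n) T (\<lambda>x. x j)"
      unfolding power_topology_def using that by (rule continuous_map_product_projection)
    have "continuous_map (prod_topology (power_topology T n) (power_topology T n))
        (prod_topology T T) (\<lambda>p. (fst p j, snd p j))"
      using continuous_map_compose[OF continuous_map_fst proj]
        continuous_map_compose[OF continuous_map_snd proj]
      by (intro continuous_map_pairedI) (simp_all add: o_def)
    from continuous_map_compose[OF this continuous_mult] show ?thesis
      by (simp add: o_def)
  qed
  then have mult: "continuous_map (prod_topology (power_topology T n) (power_topology T n))
      (power_topology T n) (\<lambda>(x, y). x \<otimes>\<^bsub>power_group G n\<^esub> y)"
    unfolding mult_power_group case_prod_beta
    by (subst (3) power_topology_def) (auto simp: continuous_map_componentwise)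
  have "continuous_map (power_topology T n) T (\<lambda>x. inv (x j))" if "j \<in> ?I" for j
    using continuous_map_compose[OF continuous_map_product_projection[OF that] continuous_inv]
    by (simp add: power_topology_def o_def)
  then have "continuous_map (power_topology T n) (power_topology T n) (\<lambda>x. \<lambda>j\<in>?I. inv (x j))"
    by (subst (2) power_topology_def) (auto simp: continuous_map_componentwise)
  \<comment> \<open>The formula is established on the underlying space only, which is enough to
    transfer continuity.\<close>
  moreover have "inv\<^bsub>power_group G n\<^esub> x = (\<lambda>j\<in>?I. inv (x j))"
    if "x \<in> topspace (power_topology T n)" for x
    using that unfolding top power_group_def by (simp add: is_group)
  ultimately have "continuous_map (power_topology T n) (power_topology T n)
      (\<lambda>x. inv\<^bsub>power_group G n\<^esub> x)"
    using continuous_map_eq by (metis (no_types, lifting))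
  with grp top mult show ?thesis
    by (simp add: topological_group_def topological_group_axioms_def)
qed

section \<open>Means and convolution\<close>

lemma mean_const:
  assumes "\<mu> \<in> means G T"
  shows "\<mu> (\<lambda>x\<in>carrier G. c) = c"
proof -
  have "\<mu> (\<lambda>x\<in>carrier G. c * (\<lambda>x\<in>carrier G. 1) x) = c * \<mu> (\<lambda>x\<in>carrier G. 1)"
    using assms RUCB_const[of 1] unfolding means_def by blast
  moreover have "(\<lambda>x\<in>carrier G. c * (\<lambda>x\<in>carrier G. 1) x) = (\<lambda>x\<in>carrier G. c)"
    by (intro restrict_ext) simp
  moreover have "\<mu> (\<lambda>x\<in>carrier G. 1) = 1"
    using assms by (simp add: means_def)
  ultimately show ?thesis
    by simp
qed

text \<open>If \<open>\<nu>\<close> takes one value on all translates of \<open>f\<close>, then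
  \<open>Phi G \<nu> f\<close> is a constant function, on which all means agree. This makes the
  final result uniform in \<open>\<mu>\<close>.\<close>

lemma conv_eq_const:
  assumes "\<mu> \<in> means G T" "f \<in> RUCB G T"
    and "\<And>g. g \<in> carrier G \<Longrightarrow> \<nu> (translate G g f) = c"
  shows "conv G T \<mu> \<nu> f = c"
proof -
  have "Phi G \<nu> f = (\<lambda>g\<in>carrier G. c)"
    unfolding Phi_def using assms(3) by (intro restrict_ext)
  then show ?thesis
    using mean_const[OF assms(1), of c] assms(2) by (simp add: conv_def compose_def)
qed

section \<open>The diagonal embedding and the mean supported on it\<close>

definition diag :: "nat \<Rightarrow> 'a \<Rightarrow> nat \<Rightarrow> 'a" where
  "diag n x = (\<lambda>j\<in>{1..n}. x)"

lemma diag_in_carrier: "x \<in> carrier G \<Longrightarrow> diag n x \<in> carrier (power_group G n)"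
  by (auto simp: diag_def carrier_power_group)

lemma RUCB_diag:
  assumes "h \<in> RUCB (power_group G n) (power_topology T n)"
  shows "(\<lambda>x\<in>carrier G. h (diag n x)) \<in> RUCB G T"
proof (rule RUCB_pullback[OF topological_group_power])
  show "continuous_map T (power_topology T n) (diag n)"
    by (auto simp: power_topology_def continuous_map_componentwise diag_def topspace_eq_carrier)
  show "diag n \<in> hom G (power_group G n)"
    by (auto simp: hom_def diag_in_carrier mult_power_group) (auto simp: diag_def)
qed (fact assms)

lemma RUCB_coord:
  assumes "f \<in> RUCB G T" "j \<in> {1..n}"
  shows "(\<lambda>x\<in>carrier (power_group G n). f (x j)) \<in> RUCB (power_group G n) (power_topology T n)"
proof -
  interpret P: topological_group "power_group G n" "power_topology T n"
    by (rule topological_group_power)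
  show ?thesis
  proof (rule P.RUCB_pullback[OF topological_group_axioms])
    show "continuous_map (power_topology T n) T (\<lambda>x. x j)"
      unfolding power_topology_def using assms(2) by (rule continuous_map_product_projection)
    show "(\<lambda>x. x j) \<in> hom (power_group G n) G"
      using assms(2) by (auto simp: hom_def carrier_power_group mult_power_group)
  qed (fact assms)
qed

lemma RUCB_coord_average:
  assumes "f \<in> RUCB G T"
  shows "coord_average G n f \<in> RUCB (power_group G n) (power_topology T n)"
proof -
  interpret P: topological_group "power_group G n" "power_topology T n"
    by (rule topological_group_power)
  let ?F = "\<lambda>j. \<lambda>x\<in>carrier (power_group G n). f (x j)"
  have "(\<lambda>x\<in>carrier (power_group G n). \<Sum>j=1..n. ?F j x)
      \<in> RUCB (power_group G n) (power_topology T n)"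
    by (intro P.RUCB_sum RUCB_coord[OF assms]) auto
  then have "(\<lambda>x\<in>carrier (power_group G n). 1 / real n *
        (\<lambda>x\<in>carrier (power_group G n). \<Sum>j=1..n. ?F j x) x)
      \<in> RUCB (power_group G n) (power_topology T n)"
    by (rule P.RUCB_comp) (intro continuous_intros)
  moreover have "(\<lambda>x\<in>carrier (power_group G n). 1 / real n *
        (\<lambda>x\<in>carrier (power_group G n). \<Sum>j=1..n. ?F j x) x) = coord_average G n f"
    unfolding coord_average_def by (intro restrict_ext) simp
  ultimately show ?thesis
    by simp
qed

text \<open>For characters \<open>\<xi>\<close> and \<open>\<eta>\<close>, each of the two
  push-forwards is a character of the power. Their midpoint is in general only a mean, and its lack
  of multiplicativity is the source of the variance.\<close>

definition diag_mean :: "(('a \<Rightarrow> real) \<Rightarrow> real) \<Rightarrow> (('a \<Rightarrow> real) \<Rightarrow> real) \<Rightarrow> nat \<Rightarrow>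
    ((nat \<Rightarrow> 'a) \<Rightarrow> real) \<Rightarrow> real" where
  "diag_mean \<xi> \<eta> n = (\<lambda>h\<in>RUCB (power_group G n) (power_topology T n).
     (\<xi> (\<lambda>x\<in>carrier G. h (diag n x)) + \<eta> (\<lambda>x\<in>carrier G. h (diag n x))) / 2)"

lemma diag_mean_in_means:
  assumes "\<xi> \<in> characters G T" "\<eta> \<in> characters G T"
  shows "diag_mean \<xi> \<eta> n \<in> means (power_group G n) (power_topology T n)"
proof -
  interpret P: topological_group "power_group G n" "power_topology T n"
    by (rule topological_group_power)
  let ?P = "power_group G n" and ?R = "RUCB (power_group G n) (power_topology T n)"
  let ?d = "\<lambda>h. \<lambda>x\<in>carrier G. h (diag n x)"
  have d_add: "?d (\<lambda>x\<in>carrier ?P. f x + h x) = (\<lambda>x\<in>carrier G. ?d f x + ?d h x)"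
    and d_scale: "?d (\<lambda>x\<in>carrier ?P. c * f x) = (\<lambda>x\<in>carrier G. c * ?d f x)"
    and d_one: "?d (\<lambda>x\<in>carrier ?P. 1) = (\<lambda>x\<in>carrier G. 1)" for f h :: "(nat \<Rightarrow> 'a) \<Rightarrow> real" and c
    by (intro restrict_ext; simp add: diag_in_carrier)+
  have add: "\<zeta> (?d (\<lambda>x\<in>carrier ?P. f x + h x)) = \<zeta> (?d f) + \<zeta> (?d h)"
    if "\<zeta> \<in> characters G T" "f \<in> ?R" "h \<in> ?R" for \<zeta> f h
    unfolding d_add using that by (intro character_add RUCB_diag)
  \<comment> \<open>Homogeneity comes from the functional calculus, applied to multiplication by
    \<open>c\<close>.\<close>
  have scale: "\<zeta> (?d (\<lambda>x\<in>carrier ?P. c * f x)) = c * \<zeta> (?d f)"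
    if "\<zeta> \<in> characters G T" "f \<in> ?R" for \<zeta> f c
    unfolding d_scale using that by (intro character_comp RUCB_diag continuous_intros)
  have pos: "0 \<le> \<zeta> (?d f)"
    if "\<zeta> \<in> characters G T" "f \<in> ?R" "\<forall>x\<in>carrier ?P. 0 \<le> f x" for \<zeta> f
    using that(3) by (intro character_ge[OF that(1) RUCB_diag[OF that(2)]]) (simp add: diag_in_carrier)
  have one: "\<zeta> (?d (\<lambda>x\<in>carrier ?P. 1)) = 1" if "\<zeta> \<in> characters G T" for \<zeta>
    unfolding d_one using that by (rule character_const)
  have R: "(\<lambda>x\<in>carrier ?P. c * f x) \<in> ?R" if "f \<in> ?R" for f c
    using that by (intro P.RUCB_comp continuous_intros)
  show ?thesis
    unfolding means_def
  proof (intro CollectI conjI ballI allI impI)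
    show "diag_mean \<xi> \<eta> n \<in> extensional ?R"
      by (simp add: diag_mean_def)
    show "diag_mean \<xi> \<eta> n (\<lambda>x\<in>carrier ?P. f x + h x) = diag_mean \<xi> \<eta> n f + diag_mean \<xi> \<eta> n h"
      if "f \<in> ?R" "h \<in> ?R" for f h
      unfolding diag_mean_def restrict_apply'[OF that(1)] restrict_apply'[OF that(2)]
        restrict_apply'[OF P.RUCB_add[OF that]]
        add[OF assms(1) that] add[OF assms(2) that] by (simp add: field_simps)
    show "diag_mean \<xi> \<eta> n (\<lambda>x\<in>carrier ?P. c * f x) = c * diag_mean \<xi> \<eta> n f" if "f \<in> ?R" for f c
      unfolding diag_mean_def restrict_apply'[OF that] restrict_apply'[OF R[OF that]]
        scale[OF assms(1) that] scale[OF assms(2) that] by (simp add: field_simps)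
    show "0 \<le> diag_mean \<xi> \<eta> n f" if "f \<in> ?R" "\<forall>x\<in>carrier ?P. 0 \<le> f x" for f
      unfolding diag_mean_def restrict_apply'[OF that(1)]
      using pos[OF assms(1) that] pos[OF assms(2) that] by simp
    show "diag_mean \<xi> \<eta> n (\<lambda>x\<in>carrier ?P. 1) = 1"
      unfolding diag_mean_def restrict_apply'[OF P.RUCB_const] one[OF assms(1)] one[OF assms(2)]
      by simp
  qed
qed

text \<open>On the diagonal the \<open>j\<close>-th coordinate of the translated point is
  \<open>g j \<otimes> x\<close>, so the average involves a possibly different translate of
  \<open>f\<close> for each \<open>j\<close>. All of them have the value \<open>c\<close> under
  \<open>\<zeta>\<close>, hence so does their average, and \<open>\<phi>\<close> passes through
  \<open>\<zeta>\<close> by \<open>character_comp\<close>.\<close>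

lemma character_diag_translate_average:
  assumes \<zeta>: "\<zeta> \<in> characters G T" and f: "f \<in> RUCB G T" and n: "n \<ge> 1"
    and \<phi>: "continuous_on UNIV \<phi>" and g: "g \<in> carrier (power_group G n)"
    and c: "\<And>k. k \<in> carrier G \<Longrightarrow> \<zeta> (translate G k f) = c"
  shows "\<zeta> (\<lambda>x\<in>carrier G. translate (power_group G n) g
      (\<lambda>x\<in>carrier (power_group G n). \<phi> (coord_average G n f x)) (diag n x)) = (\<phi> c :: real)"
proof -
  interpret P: topological_group "power_group G n" "power_topology T n"
    by (rule topological_group_power)
  let ?F = "\<lambda>j. translate G (g j) f"
  let ?s = "\<lambda>x\<in>carrier G. \<Sum>j=1..n. ?F j x"
  have gj: "g j \<in> carrier G" if "j \<in> {1..n}" for j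
    using g that by (auto simp: carrier_power_group)
  have F: "?F j \<in> RUCB G T" if "j \<in> {1..n}" for j
    using f gj[OF that] by (rule RUCB_translate)
  have s: "?s \<in> RUCB G T"
    using F by (intro RUCB_sum) auto
  have "\<zeta> ?s = (\<Sum>j=1..n. \<zeta> (?F j))"
    using F by (intro character_sum[OF \<zeta>]) auto
  also have "\<dots> = real n * c"
    using c gj by simp
  finally have \<zeta>_s: "\<zeta> ?s = real n * c" .
  have "translate (power_group G n) g
      (\<lambda>x\<in>carrier (power_group G n). \<phi> (coord_average G n f x)) (diag n x)
      = \<phi> (1 / real n * ?s x)" if x: "x \<in> carrier G" for x
  proof -
    have gx: "g \<otimes>\<^bsub>power_group G n\<^esub> diag n x \<in> carrier (power_group G n)"
      using g diag_in_carrier[OF x] by simp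
    have "coord_average G n f (g \<otimes>\<^bsub>power_group G n\<^esub> diag n x)
        = 1 / real n * (\<Sum>j=1..n. f ((g \<otimes>\<^bsub>power_group G n\<^esub> diag n x) j))"
      using gx by (simp add: coord_average_def)
    also have "(\<Sum>j=1..n. f ((g \<otimes>\<^bsub>power_group G n\<^esub> diag n x) j)) = (\<Sum>j=1..n. ?F j x)"
      using x by (intro sum.cong) (auto simp: mult_power_group diag_def translate_apply)
    finally show ?thesis
      using x gx by (simp add: P.translate_apply[OF diag_in_carrier[OF x]])
  qed
  then have eq: "(\<lambda>x\<in>carrier G. translate (power_group G n) g
      (\<lambda>x\<in>carrier (power_group G n). \<phi> (coord_average G n f x)) (diag n x))
      = (\<lambda>x\<in>carrier G. \<phi> (1 / real n * ?s x))"
    by (intro restrict_ext)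
  have "\<zeta> (\<lambda>x\<in>carrier G. \<phi> (1 / real n * ?s x)) = \<phi> (1 / real n * \<zeta> ?s)"
  proof (rule character_comp[OF \<zeta> s])
    show "continuous_on UNIV (\<lambda>t. \<phi> (1 / real n * t))"
      by (rule continuous_on_compose2[OF \<phi>]) (intro continuous_intros subset_UNIV)+
  qed
  \<comment> \<open>Here \<open>n\<close> is nonzero and cancels; for \<open>n = 0\<close> the
    convention for division by zero would give \<open>\<phi> 0\<close>.\<close>
  also have "\<dots> = \<phi> c"
    using n \<zeta>_s by simp
  finally show ?thesis
    unfolding eq .
qed

text \<open>All translates receive the same value from \<open>diag_mean\<close>, so
  \<open>conv_eq_const\<close> applies. A general \<open>\<phi>\<close> is allowed because two
  instances are needed: the identity for the mean and a centered square for the variance.\<close>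

lemma conv_diag_mean:
  assumes \<xi>: "\<xi> \<in> characters G T" "\<And>k. k \<in> carrier G \<Longrightarrow> \<xi> (translate G k f) = 1"
    and \<eta>: "\<eta> \<in> characters G T" "\<And>k. k \<in> carrier G \<Longrightarrow> \<eta> (translate G k f) = 0"
    and f: "f \<in> RUCB G T" and n: "n \<ge> 1" and \<phi>: "continuous_on UNIV \<phi>"
    and \<mu>: "\<mu> \<in> means (power_group G n) (power_topology T n)"
  shows "conv (power_group G n) (power_topology T n) \<mu> (diag_mean \<xi> \<eta> n)
      (\<lambda>x\<in>carrier (power_group G n). \<phi> (coord_average G n f x)) = (\<phi> 1 + \<phi> 0) / 2"
proof -
  interpret P: topological_group "power_group G n" "power_topology T n"
    by (rule topological_group_power)
  let ?H = "\<lambda>x\<in>carrier (power_group G n). \<phi> (coord_average G n f x)"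
  have H: "?H \<in> RUCB (power_group G n) (power_topology T n)"
    using RUCB_coord_average[OF f] \<phi> by (rule P.RUCB_comp)
  show ?thesis
  proof (rule P.conv_eq_const[OF \<mu> H])
    fix g assume g: "g \<in> carrier (power_group G n)"
    have "\<xi> (\<lambda>x\<in>carrier G. translate (power_group G n) g ?H (diag n x)) = \<phi> 1"
      "\<eta> (\<lambda>x\<in>carrier G. translate (power_group G n) g ?H (diag n x)) = \<phi> 0"
      using character_diag_translate_average[OF _ f n \<phi> g] \<xi> \<eta> by blast+
    then show "diag_mean \<xi> \<eta> n (translate (power_group G n) g ?H) = (\<phi> 1 + \<phi> 0) / 2"
      unfolding diag_mean_def restrict_apply'[OF P.RUCB_translate[OF H g]] by simp
  qed
qed

end

theorem theorem5p1:
  fixes G :: "('a, 'b) monoid_scheme" and T :: "'a topology"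
  assumes "topological_group G T"
    and "\<exists>A B. closedin (characters_topology G T) A \<and> closedin (characters_topology G T) B \<and>
           invariant_set G T A \<and> invariant_set G T B \<and>
           A \<noteq> {} \<and> B \<noteq> {} \<and> A \<inter> B = {}"
  shows "\<exists>f\<in>RUCB G T. (\<forall>x\<in>carrier G. 0 \<le> f x \<and> f x \<le> 1) \<and>
    (\<forall>n::nat. n \<ge> 1 \<longrightarrow>
      (\<exists>\<nu>\<in>means (power_group G n) (power_topology T n).
        \<forall>\<mu>\<in>means (power_group G n) (power_topology T n).
          conv (power_group G n) (power_topology T n) \<mu> \<nu>
            (\<lambda>x\<in>carrier (power_group G n).
               (coord_average G n f x
                 - conv (power_group G n) (power_topology T n) \<mu> \<nu> (coord_average G n f))\<^sup>2)
          = 1 / 4))"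
proof -
  interpret topological_group G T by fact
  obtain A B where A: "closedin (characters_topology G T) A" "invariant_set G T A" "A \<noteq> {}"
    and B: "closedin (characters_topology G T) B" "invariant_set G T B" "B \<noteq> {}"
    and disj: "A \<inter> B = {}"
    using assms(2) by blast
  obtain f where f: "f \<in> RUCB G T" "\<And>x. x \<in> carrier G \<Longrightarrow> 0 \<le> f x \<and> f x \<le> 1"
    "\<And>\<xi>. \<xi> \<in> A \<Longrightarrow> \<xi> f = 1" "\<And>\<xi>. \<xi> \<in> B \<Longrightarrow> \<xi> f = 0"
    using separate_closed_sets[OF A(1) B(1) disj] by metis
  obtain \<xi> \<eta> where "\<xi> \<in> A" "\<eta> \<in> B"
    using A(3) B(3) by blast
  have \<xi>: "\<xi> \<in> characters G T" and \<eta>: "\<eta> \<in> characters G T"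
    using \<open>\<xi> \<in> A\<close> \<open>\<eta> \<in> B\<close> closedin_subset[OF A(1)] closedin_subset[OF B(1)]
    by (auto simp: topspace_characters_topology)
  \<comment> \<open>The left side is the value at \<open>f\<close> of the character
    \<open>\<xi>\<close> moved by \<open>k\<close>, which remains in \<open>A\<close> by
    invariance.\<close>
  have \<xi>_orbit: "\<xi> (translate G k f) = 1" if "k \<in> carrier G" for k
    using A(2) \<open>\<xi> \<in> A\<close> that f(3)[of "char_action G T k \<xi>"] f(1)
    by (simp add: invariant_set_def char_action_def)
  have \<eta>_orbit: "\<eta> (translate G k f) = 0" if "k \<in> carrier G" for k
    using B(2) \<open>\<eta> \<in> B\<close> that f(4)[of "char_action G T k \<eta>"] f(1)
    by (simp add: invariant_set_def char_action_def)
  have "conv (power_group G n) (power_topology T n) \<mu> (diag_mean \<xi> \<eta> n)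
      (\<lambda>x\<in>carrier (power_group G n). (coord_average G n f x
        - conv (power_group G n) (power_topology T n) \<mu> (diag_mean \<xi> \<eta> n) (coord_average G n f))\<^sup>2)
      = 1 / 4"
    if n: "n \<ge> 1" and \<mu>: "\<mu> \<in> means (power_group G n) (power_topology T n)" for n \<mu>
  proof -
    have "(\<lambda>x\<in>carrier (power_group G n). coord_average G n f x) = coord_average G n f"
      using RUCB_coord_average[OF f(1)] by (simp add: RUCB_def extensional_restrict)
    then have mean: "conv (power_group G n) (power_topology T n) \<mu> (diag_mean \<xi> \<eta> n)
        (coord_average G n f) = 1 / 2"
      using conv_diag_mean[OF \<xi> \<xi>_orbit \<eta> \<eta>_orbit f(1) n continuous_on_id \<mu>] by simp
    \<comment> \<open>The center is the mean just computed; this square equals \<open>1 / 4\<close>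
      at both 0 and 1, hence so does the average of the two values.\<close>
    have "continuous_on UNIV (\<lambda>t. (t - 1 / 2)\<^sup>2 :: real)"
      by (intro continuous_intros)
    from conv_diag_mean[OF \<xi> \<xi>_orbit \<eta> \<eta>_orbit f(1) n this \<mu>] show ?thesis
      unfolding mean by (simp add: power2_eq_square)
  qed
  then show ?thesis
    using f(1,2) diag_mean_in_means[OF \<xi> \<eta>] by blast
qed

end
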